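(* If $n$ is a non-negative integer and $t$ is any integer, then $$\sum_{k=1}^n(-1)^{k-1}\frac{k}{n+k}\binom{n+k}{n-k}L_{3k+t}=\begin{cases}\frac12L_{t+3}L_n,& n\text{ odd};\\ -\frac52F_{t+3}F_n,& n\text{ even};\end{cases}$$ $$\sum_{k=1}^n(-1)^{k-1}\frac{k}{n+k}\binom{n+k}{n-k}F_{3k+t}=\begin{cases}\frac12F_{t+3}L_n,& n\text{ odd};\\ -\frac12L_{t+3}F_n,& n\text{ even}.\end{cases}$$
   Context: $F_n$ and $L_n$ ($n\in\mathbb{Z}$) are the Fibonacci and Lucas numbers: $F_0=0$, $F_1=1$, $F_n=F_{n-1}+F_{n-2}$; $L_0=2$, $L_1=1$, $L_n=L_{n-1}+L_{n-2}$, extended to negative indices by $F_{-n}=(-1)^{n-1}F_n$, $L_{-n}=(-1)^nL_n$. An empty sum is $0$. *)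

theory Defs
  imports Complex_Main "HOL-Number_Theory.Fib"
begin

fun lucas :: "nat \<Rightarrow> nat" where
  "lucas 0 = 2"
| "lucas (Suc 0) = 1"
| "lucas (Suc (Suc n)) = lucas (Suc n) + lucas n"

(* The extensions to negative indices: F(-m) = (-1)^(m-1) F(m) and L(-m) = (-1)^m L(m).
   In the negative branch the index is -m with m >= 1, so that m - 1 is not truncated. *)

definition fib_int :: "int \<Rightarrow> int" where
  "fib_int i = (if i \<ge> 0 then int (fib (nat i))
                else (- 1) ^ (nat (- i) - 1) * int (fib (nat (- i))))"

definition lucas_int :: "int \<Rightarrow> int" where
  "lucas_int i = (if i \<ge> 0 then int (lucas (nat i))
                  else (- 1) ^ nat (- i) * int (lucas (nat (- i))))"

end

theory Submission
  imports Defs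
begin

text \<open>
  Since k/(n+k) binom(n+k, n-k) = binom(n+k-1, 2k-1)/2, the weights have second difference in n
  equal to the weight at (n+1, k-1). Hence, for every sequence G satisfying the Fibonacci recurrence,
  the doubled sums A(n,t) satisfy A(n+2,t) = 2 A(n+1,t) - A(n,t) - A(n+1,t+3), and the closed form
  obeys the same recurrence. The companion sequence H(m) = 2 G(m+1) - G(m) is 5F for G = L and L for
  G = F, which yields both identities at once.
\<close>

lemma fib_int_of_nat: "fib_int (int m) = int (fib m)"
  by (simp add: fib_int_def)

lemma lucas_int_of_nat: "lucas_int (int m) = int (lucas m)"
  by (simp add: lucas_int_def)

text \<open>For m >= 1, \<open>Suc m\<close> has the parity of m - 1, and the formula survives at m
  = 0 since F_0 = 0.\<close>

lemma fib_int_uminus: "fib_int (- int m) = (- 1) ^ Suc m * int (fib m)"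
  by (cases m) (simp_all add: fib_int_def nat_add_distrib)

lemma lucas_int_uminus: "lucas_int (- int m) = (- 1) ^ m * int (lucas m)"
  by (cases "m = 0") (simp_all add: lucas_int_def)

text \<open>Outside i = -1, the indices i, i + 1, i + 2 are all nonnegative or all nonpositive, so
  one sign formula serves all three terms of the recurrence.\<close>

lemma int_cases_uminus_Suc_Suc:
  obtains (nonneg) m where "i = int m" | (minus_one) "i = - 1"
    | (neg) m where "i = - int (Suc (Suc m))"
proof -
  have "i \<ge> 0 \<or> i = - 1 \<or> i \<le> - 2" by linarith
  then show ?thesis
  proof (elim disjE)
    assume "i \<ge> 0"
    then show ?thesis using nonneg[of "nat i"] by simp
  next
    assume "i = - 1"
    then show ?thesis by (rule minus_one)
  next
    assume "i \<le> - 2"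
    then show ?thesis using neg[of "nat (- i - 2)"] by simp
  qed
qed

lemma fib_int_rec: "fib_int (i + 2) = fib_int (i + 1) + fib_int i"
proof (cases i rule: int_cases_uminus_Suc_Suc)
  case (nonneg m)
  then have "i + 2 = int (Suc (Suc m))" "i + 1 = int (Suc m)" by simp_all
  then show ?thesis unfolding nonneg by (simp only: fib_int_of_nat) simp
next
  case minus_one
  then show ?thesis by (simp add: fib_int_def)
next
  case (neg m)
  then have "i + 2 = - int m" "i + 1 = - int (Suc m)" by simp_all
  then show ?thesis unfolding neg by (simp only: fib_int_uminus) (simp add: algebra_simps)
qed

lemma lucas_int_rec: "lucas_int (i + 2) = lucas_int (i + 1) + lucas_int i"
proof (cases i rule: int_cases_uminus_Suc_Suc)
  case (nonneg m)
  then have "i + 2 = int (Suc (Suc m))" "i + 1 = int (Suc m)" by simp_all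
  then show ?thesis unfolding nonneg by (simp only: lucas_int_of_nat) simp
next
  case minus_one
  then show ?thesis by (simp add: lucas_int_def)
next
  case (neg m)
  then have "i + 2 = - int m" "i + 1 = - int (Suc m)" by simp_all
  then show ?thesis unfolding neg by (simp only: lucas_int_uminus) (simp add: algebra_simps)
qed

lemma lucas_fib: "int (lucas m) = 2 * int (fib (Suc m)) - int (fib m)"
  by (induction m rule: lucas.induct) simp_all

lemma lucas_int_fib_int: "lucas_int i = 2 * fib_int (i + 1) - fib_int i"
proof (cases "i \<ge> 0")
  case True
  then obtain m where i: "i = int m" by (rule nonneg_int_cases)
  then have "i + 1 = int (Suc m)" by simp
  then show ?thesis unfolding i by (simp only: fib_int_of_nat lucas_int_of_nat lucas_fib)
next
  case False
  then obtain m where i: "i = - int (Suc m)" using negD[of i] by auto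
  then have "i + 1 = - int m" by simp
  then show ?thesis unfolding i
    by (simp only: fib_int_uminus lucas_int_uminus lucas_fib) (simp add: algebra_simps)
qed

text \<open>Expanding the Lucas values gives 4 F(i+2) - 4 F(i+1) + F(i), which the recurrence
  collapses.\<close>

lemma fib_int_lucas_int: "5 * fib_int i = 2 * lucas_int (i + 1) - lucas_int i"
  using fib_int_rec[of i] by (simp add: lucas_int_fib_int add.assoc)

lemma lucas_eq_fib_add: "lucas (Suc m) = fib (Suc (Suc m)) + fib m"
  using lucas_fib[of "Suc m"] by simp

lemma fib_eq_lucas_add: "5 * fib (Suc m) = lucas (Suc (Suc m)) + lucas m"
  using lucas_fib[of "Suc (Suc m)"] lucas_fib[of m] by simp

text \<open>Symmetry turns the lower index n - k into 2k, and absorption cancels n + k. Writing k -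
  1 prepares the shift to a sum from zero.\<close>

lemma binomial_weight:
  assumes "k \<ge> 1" "k \<le> n"
  shows "real k / real (n + k) * real ((n + k) choose (n - k))
    = real ((n + (k - 1)) choose Suc (2 * (k - 1))) / 2"
proof -
  obtain j where k: "k = Suc j" using assms(1) by (cases k) simp_all
  have "(n + k) choose (n - k) = Suc (n + j) choose Suc (Suc (2 * j))"
    using binomial_symmetric[of "n - k" "n + k"] assms(2)
    by (simp add: k mult_2 del: binomial_Suc_Suc)
  moreover have "real (Suc (Suc (2 * j))) * real (Suc (n + j) choose Suc (Suc (2 * j)))
      = real (Suc (n + j)) * real ((n + j) choose Suc (2 * j))"
    unfolding of_nat_mult[symmetric] by (subst Suc_times_binomial_eq) simp
  ultimately show ?thesis
    by (simp add: k field_simps)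
qed

text \<open>Pascal's rule applied twice; the additive form avoids subtraction on naturals.\<close>

lemma binomial_second_difference:
  "(Suc (Suc n) + Suc k choose Suc (2 * Suc k)) + (n + Suc k choose Suc (2 * Suc k))
    = 2 * (Suc n + Suc k choose Suc (2 * Suc k)) + (Suc n + k choose Suc (2 * k))"
proof -
  define a where "a = n + Suc k"
  define j where "j = Suc (2 * k)"
  have "Suc (Suc n) + Suc k = Suc (Suc a)" "Suc n + Suc k = Suc a" "Suc n + k = a"
    "Suc (2 * Suc k) = Suc (Suc j)" "n + Suc k = a"
    by (simp_all add: a_def j_def)
  then show ?thesis
    unfolding j_def[symmetric] by simp
qed

text \<open>Twice the sum of the theorem with k shifted down by one; the doubling keeps it
  integral.\<close>

definition binomial_alt_sum :: "(int \<Rightarrow> int) \<Rightarrow> nat \<Rightarrow> int \<Rightarrow> int" where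
  "binomial_alt_sum G n t =
    (\<Sum>k<n. (- 1) ^ k * int ((n + k) choose Suc (2 * k)) * G (3 * int k + 3 + t))"

text \<open>For k >= n the lower index 2k + 1 exceeds n + k. Sums for consecutive n can thus share
  one range and be combined termwise.\<close>

lemma binomial_alt_sum_extend:
  assumes "n \<le> N"
  shows "binomial_alt_sum G n t =
    (\<Sum>k<N. (- 1) ^ k * int ((n + k) choose Suc (2 * k)) * G (3 * int k + 3 + t))"
  unfolding binomial_alt_sum_def
  by (rule sum.mono_neutral_left) (use assms in \<open>auto simp: binomial_eq_0\<close>)

lemma binomial_alt_sum_rec:
  "binomial_alt_sum G (Suc (Suc n)) t
    = 2 * binomial_alt_sum G (Suc n) t - binomial_alt_sum G n t - binomial_alt_sum G (Suc n) (t + 3)"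
proof -
  define f where
    "f m k = (- 1) ^ k * int ((m + k) choose Suc (2 * k)) * G (3 * int k + 3 + t)" for m k
  have ext: "binomial_alt_sum G m t = (\<Sum>k<Suc (Suc n). f m k)" if "m \<le> Suc (Suc n)" for m
    unfolding f_def using binomial_alt_sum_extend[OF that] .
  \<comment> \<open>Passing from k + 1 to k flips the sign and moves a shift of 3 into t.\<close>
  have step: "f (Suc (Suc n)) (Suc k) - 2 * f (Suc n) (Suc k) + f n (Suc k)
      = - ((- 1) ^ k * int ((Suc n + k) choose Suc (2 * k)) * G (3 * int k + 3 + (t + 3)))" for k
  proof -
    have *: "3 * int (Suc k) + 3 + t = 3 * int k + 3 + (t + 3)" by simp
    have "int (Suc (Suc n) + Suc k choose Suc (2 * Suc k)) + int (n + Suc k choose Suc (2 * Suc k))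
      = 2 * int (Suc n + Suc k choose Suc (2 * Suc k)) + int (Suc n + k choose Suc (2 * k))"
      using arg_cong[OF binomial_second_difference[of n k], of int]
      by (simp only: of_nat_add of_nat_mult of_nat_numeral)
    then have **: "int (Suc n + k choose Suc (2 * k))
      = int (Suc (Suc n) + Suc k choose Suc (2 * Suc k)) + int (n + Suc k choose Suc (2 * Suc k))
        - 2 * int (Suc n + Suc k choose Suc (2 * Suc k))" by linarith
    show ?thesis unfolding f_def * **
      by (simp del: binomial_Suc_Suc add_Suc add_Suc_right mult_Suc_right add: algebra_simps)
  qed
  have "binomial_alt_sum G (Suc (Suc n)) t - 2 * binomial_alt_sum G (Suc n) t + binomial_alt_sum G n t
      = (\<Sum>k<Suc (Suc n). f (Suc (Suc n)) k - 2 * f (Suc n) k + f n k)"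
    by (simp only: ext sum.distrib sum_subtractf sum_distrib_left le_refl le_SucI)
  \<comment> \<open>The term at k = 0 drops out: its coefficient m choose 1 is linear in m.\<close>
  also have "\<dots> = (\<Sum>k<Suc n. f (Suc (Suc n)) (Suc k) - 2 * f (Suc n) (Suc k) + f n (Suc k))"
    by (subst sum.lessThan_Suc_shift) (simp add: f_def algebra_simps)
  also have "\<dots> = - binomial_alt_sum G (Suc n) (t + 3)"
    by (simp only: step sum_negf binomial_alt_sum_def)
  finally show ?thesis by linarith
qed

text \<open>Two-step induction on n; t stays arbitrary because the recurrence also calls the
  hypothesis at t + 3.\<close>

lemma binomial_alt_sum_closed_form:
  assumes rec: "\<And>i. G (i + 2) = G (i + 1) + G i"
  shows "binomial_alt_sum G n t
    = (if odd n then G (t + 3) * int (lucas n) else - (2 * G (t + 4) - G (t + 3)) * int (fib n))"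
proof (induction n arbitrary: t rule: lucas.induct)
  case 1
  then show ?case by (simp add: binomial_alt_sum_def)
next
  case 2
  then show ?case by (simp add: binomial_alt_sum_def add.commute)
next
  case (3 n)
  \<comment> \<open>All values of \<open>G\<close> are expressed through G(t+3) and G(t+4), so that
    coefficients can be compared.\<close>
  have G: "G (t + 6) = 2 * G (t + 4) + G (t + 3)"
    "G (t + 7) = 3 * G (t + 4) + 2 * G (t + 3)"
    using rec[of "t + 3"] rec[of "t + 4"] rec[of "t + 5"] by (simp_all add: add.assoc)
  \<comment> \<open>\<open>L\<close> closes the even case, where G(t+6) - 2 G(t+3) = 2 G(t+4) -
    G(t+3); \<open>F\<close> closes the odd case, where the coefficient of F_{n+1} reduces to 5
    G(t+3).\<close>
  have L: "int (lucas (Suc n)) = int (fib (Suc (Suc n))) + int (fib n)"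
    by (simp only: lucas_eq_fib_add of_nat_add)
  have F: "int (lucas (Suc (Suc n))) = 5 * int (fib (Suc n)) - int (lucas n)"
    using fib_eq_lucas_add[of n] by linarith
  have shift: "t + 3 + 3 = t + 6" "t + 3 + 4 = t + 7" by simp_all
  show ?case
    unfolding binomial_alt_sum_rec 3 shift G F L even_Suc
    by (cases "odd n") (simp_all only: if_True if_False not_not simp_thms, simp_all add: algebra_simps)
qed

lemma sum_eq_binomial_alt_sum:
  "(\<Sum>k=1..n. (- 1) ^ (k - 1) * (real k / real (n + k)) * real ((n + k) choose (n - k))
      * real_of_int (G (3 * int k + t)))
    = real_of_int (binomial_alt_sum G n t) / 2"
proof -
  have "(\<Sum>k=1..n. (- 1) ^ (k - 1) * (real k / real (n + k)) * real ((n + k) choose (n - k))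
      * real_of_int (G (3 * int k + t)))
    = (\<Sum>k=1..n. (- 1) ^ (k - 1) * (real ((n + (k - 1)) choose Suc (2 * (k - 1))) / 2)
      * real_of_int (G (3 * int k + t)))"
    by (rule sum.cong[OF refl]) (subst binomial_weight[symmetric]; simp)
  also have "\<dots> = (\<Sum>k<n. (- 1) ^ k * (real ((n + k) choose Suc (2 * k)) / 2)
      * real_of_int (G (3 * int k + 3 + t)))"
    by (simp add: sum.atLeast1_atMost_eq algebra_simps del: binomial_Suc_Suc)
  also have "\<dots> = real_of_int (binomial_alt_sum G n t) / 2"
    by (simp add: binomial_alt_sum_def sum_divide_distrib)
  finally show ?thesis .
qed

theorem theorem17:
  fixes n :: nat and t :: int
  shows "(\<Sum>k=1..n. (- 1) ^ (k - 1) * (real k / real (n + k)) * real ((n + k) choose (n - k))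
            * real_of_int (lucas_int (3 * int k + t)))
         = (if odd n then 1 / 2 * real_of_int (lucas_int (t + 3)) * real_of_int (lucas_int (int n))
            else - (5 / 2) * real_of_int (fib_int (t + 3)) * real_of_int (fib_int (int n)))
       \<and> (\<Sum>k=1..n. (- 1) ^ (k - 1) * (real k / real (n + k)) * real ((n + k) choose (n - k))
            * real_of_int (fib_int (3 * int k + t)))
         = (if odd n then 1 / 2 * real_of_int (fib_int (t + 3)) * real_of_int (lucas_int (int n))
            else - (1 / 2) * real_of_int (lucas_int (t + 3)) * real_of_int (fib_int (int n)))"
proof -
  have companion: "2 * lucas_int (t + 4) - lucas_int (t + 3) = 5 * fib_int (t + 3)"
    "2 * fib_int (t + 4) - fib_int (t + 3) = lucas_int (t + 3)"
    using fib_int_lucas_int[of "t + 3"] lucas_int_fib_int[of "t + 3"]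
    by (simp_all add: add.assoc)
  show ?thesis
    unfolding sum_eq_binomial_alt_sum binomial_alt_sum_closed_form[OF lucas_int_rec]
      binomial_alt_sum_closed_form[OF fib_int_rec] companion
    by (simp add: fib_int_of_nat lucas_int_of_nat)
qed

end
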